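(* Let $J(\theta)=\theta^\top A\theta+b^\top\theta+c$, $\theta\in\mathbb{R}^{nm}$, be the reduced quadratic objective with $A,b,c$ as defined in the context. If $\tilde\Lambda\succ0$ is symmetric, $\Sigma\succeq0$ is symmetric, and $\phi,\eta,\gamma\ge0$, then $J$ is concave.
   Context: Fix $T>0$ and a filtered probability space $(\Omega,\mathcal F,(\mathcal F_t)_{t\in[0,T]},\mathbb{P})$ satisfying the usual conditions. The information path $Z_t\in\mathbb{R}^{d_z}$, $t\in[0,T]$, is continuous and adapted. The unaffected mid-prices of the $n$ assets are $P_t=\pi_P Z_t\in\mathbb{R}^n$, where $\pi_P:\mathbb{R}^{d_z}\to\mathbb{R}^n$ is a fixed (linear) projection. Signature features. For a truncation level $N\in\mathbb{N}$, let $\mathcal T^{\le N}(\mathbb{R}^{d_z})=\bigoplus_{k=0}^N(\mathbb{R}^{d_z})^{\otimes k}$. The truncated signature $S^{\le N}(\mathbf Z)_{0,t}\in\mathcal T^{\le N}(\mathbb{R}^{d_z})$ is the collection of iterated integrals $S^I(\mathbf Z)_{0,t}=\int_{0<u_1<\dots<u_k<t}\circ\,\mathrm{d}Z^{i_1}_{u_1}\cdots\circ\mathrm{d}Z^{i_k}_{u_k}$ over words $I=(i_1,\dots,i_k)$ in the letters $\{1,\dots,d_z\}$ with $k\le N$. The level-0 entry is $1$. The iterated integrals are those of the chosen lift $\mathbf Z$, given above its defining levels by Lyons' extension. After fixing a basis, $x_t\in\mathbb{R}^m$ with $m=\dim\mathcal T^{\le N}(\mathbb{R}^{d_z})$ is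 the coordinate vector of $S^{\le N}(\mathbf Z)_{0,t}$, and $y_t=\int_0^t x_u\,\mathrm{d}u$. Standing assumptions. (1) $Z$ comes with a chosen $(\mathcal F_t)$-adapted geometric rough-path lift $\mathbf Z=(1,\mathbf Z^1,\dots,\mathbf Z^{\lfloor p\rfloor})$ of finite $p$-variation for some $p\ge1$, with $\mathbf Z^1_{s,t}=Z_t-Z_s$. (2) $\mathbb{E}[\int_0^T\|x_t\|^2\,\mathrm{d}t]<\infty$ and $\mathbb{E}[\int_0^T\|P_t\|^2\|y_t\|^2\,\mathrm{d}t]<\infty$. (3) For $B\in\mathbb{R}^{n\times m}$ the control $v_t=Bx_t$ is progressively measurable with $\mathbb{E}[\int_0^T\|v_t\|^2\,\mathrm{d}t]<\infty$, and the law of $Z$ does not depend on $B$. Reduced objective. Let $K\in\mathbb{R}^{n\times m}$ and $Q_0\in\mathbb{R}^n$ be deterministic, $\tilde\Lambda,\Sigma\in\mathbb{R}^{n\times n}$, and $\theta=\operatorname{vec}(B)\in\mathbb{R}^{nm}$ (column-major vectorisation). With $\alpha_t=Kx_t$, $v_t=Bx_t$, $Q_t=Q_0+\int_0^t v_u\,\mathrm{d}u$, the objective $$\mathbb{E}\Big[\int_0^T\big(Q_t^\top\alpha_t-v_t^\top\tilde\Lambda v_t-\phi\,Q_t^\top\Sigma Q_t-\eta(Q_t^\top P_t)^2\big)\mathrm{d}t-\gamma\|Q_T\|^2\Big]$$ equals $J(\theta)=\theta^\top A\theta+b^\top\theta+c$, where ($\otimes$ is the Kronecker product, $I_n$ the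 identity) $$A=-\mathbb{E}\Big[\int_0^T(x_tx_t^\top)\otimes\tilde\Lambda\,\mathrm{d}t+\int_0^T(y_ty_t^\top)\otimes(\phi\Sigma+\eta P_tP_t^\top)\,\mathrm{d}t+\gamma\,(y_Ty_T^\top)\otimes I_n\Big],$$ $$b=\mathbb{E}\Big[\int_0^T y_t\otimes(Kx_t-2\phi\Sigma Q_0-2\eta P_tP_t^\top Q_0)\,\mathrm{d}t-2\gamma\,(y_T\otimes Q_0)\Big],$$ $$c=\mathbb{E}\Big[\int_0^T\big(Q_0^\top Kx_t-\phi Q_0^\top\Sigma Q_0-\eta(Q_0^\top P_t)^2\big)\mathrm{d}t-\gamma\|Q_0\|^2\Big].$$ *)

theory Defs
  imports "HOL-Probability.Probability"
begin

text \<open>Only the values of \<open>F\<close> on \<open>{0..T}\<close> matter. The last conjunct (\<open>F 0\<close> contains every subset of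
  every null set) includes completeness of \<open>M\<close>.\<close>

definition usual_conditions :: "'a measure \<Rightarrow> real \<Rightarrow> (real \<Rightarrow> 'a measure) \<Rightarrow> bool" where
  "usual_conditions M T F \<longleftrightarrow>
     (\<forall>t\<in>{0..T}. subalgebra M (F t)) \<and>
     (\<forall>s\<in>{0..T}. \<forall>t\<in>{0..T}. s \<le> t \<longrightarrow> sets (F s) \<subseteq> sets (F t)) \<and>
     (\<forall>t\<in>{0..<T}. sets (F t) = (\<Inter>s\<in>{t<..T}. sets (F s))) \<and>
     (\<forall>N\<in>null_sets M. \<forall>A. A \<subseteq> N \<longrightarrow> A \<in> sets (F 0))"

definition adapted ::
  "real \<Rightarrow> (real \<Rightarrow> 'a measure) \<Rightarrow> (real \<Rightarrow> 'a \<Rightarrow> 'b::topological_space) \<Rightarrow> bool" where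
  "adapted T F X \<longleftrightarrow> (\<forall>t\<in>{0..T}. X t \<in> borel_measurable (F t))"

definition progressively_measurable ::
  "real \<Rightarrow> (real \<Rightarrow> 'a measure) \<Rightarrow> (real \<Rightarrow> 'a \<Rightarrow> 'b::topological_space) \<Rightarrow> bool" where
  "progressively_measurable T F X \<longleftrightarrow>
     (\<forall>t\<in>{0..T}. (\<lambda>(s, \<omega>). X s \<omega>) \<in> borel_measurable (restrict_space borel {0..t} \<Otimes>\<^sub>M F t))"

text \<open>A tensor over \<open>real ^ 'z\<close> is given by its coefficients on words in the letters \<open>'z\<close>; words of
  length \<open>k\<close> index the standard basis of the \<open>k\<close>-th tensor power.\<close>

type_synonym 'z tensor = "'z list \<Rightarrow> real"

definition trunc_tensors :: "nat \<Rightarrow> 'z tensor set" where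
  "trunc_tensors N = {a. \<forall>w. N < length w \<longrightarrow> a w = 0}"

definition level_norm :: "nat \<Rightarrow> 'z::finite tensor \<Rightarrow> real" where
  "level_norm k a = L2_set a {w. length w = k}"

definition tensor_mult :: "'z tensor \<Rightarrow> 'z tensor \<Rightarrow> 'z tensor" where
  "tensor_mult a b w = (\<Sum>i\<le>length w. a (take i w) * b (drop i w))"

definition dissections :: "real \<Rightarrow> real list set" where
  "dissections T = {D. D \<noteq> [] \<and> sorted_wrt (<) D \<and> hd D = 0 \<and> last D = T}"

definition level_variation ::
  "real \<Rightarrow> real \<Rightarrow> nat \<Rightarrow> (real \<Rightarrow> real \<Rightarrow> 'z::finite tensor) \<Rightarrow> ennreal" where
  "level_variation p T k G =
     (SUP D\<in>dissections T. ennreal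
        ((\<Sum>l<length D - 1. level_norm k (G (D ! l) (D ! Suc l)) powr (p / real k))
           powr (real k / p)))"

text \<open>Continuous functionals on the simplex \<open>0 \<le> s \<le> t \<le> T\<close> with values in the tensors truncated at
  degree \<open>n\<close> that satisfy Chen's identity and have finite \<open>p\<close>-variation. For \<open>n = \<lfloor>p\<rfloor>\<close> these are the
  \<open>p\<close>-rough paths. Coefficients on words longer than \<open>n\<close> are irrelevant.\<close>

definition rough_functional ::
  "real \<Rightarrow> real \<Rightarrow> nat \<Rightarrow> (real \<Rightarrow> real \<Rightarrow> 'z::finite tensor) \<Rightarrow> bool" where
  "rough_functional p T n X \<longleftrightarrow>
     (\<forall>w. length w \<le> n \<longrightarrow>
        continuous_on {(s, t). 0 \<le> s \<and> s \<le> t \<and> t \<le> T} (\<lambda>(s, t). X s t w)) \<and>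
     (\<forall>s t. 0 \<le> s \<and> s \<le> t \<and> t \<le> T \<longrightarrow> X s t [] = 1) \<and>
     (\<forall>s u t w. 0 \<le> s \<and> s \<le> u \<and> u \<le> t \<and> t \<le> T \<and> length w \<le> n \<longrightarrow>
        X s t w = tensor_mult (X s u) (X u t) w) \<and>
     (\<forall>k\<in>{1..n}. level_variation p T k X < \<infinity>)"

definition pvar_dist ::
  "real \<Rightarrow> real \<Rightarrow> (real \<Rightarrow> real \<Rightarrow> 'z::finite tensor) \<Rightarrow> (real \<Rightarrow> real \<Rightarrow> 'z tensor) \<Rightarrow> ennreal" where
  "pvar_dist p T X Y =
     (SUP k\<in>{1..nat \<lfloor>p\<rfloor>}. level_variation p T k (\<lambda>s t w. X s t w - Y s t w))"

text \<open>Limits of \<open>1\<close>-rough paths in the \<open>p\<close>-variation metric, as in Lyons. A multiplicative functional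
  of degree \<open>\<lfloor>p\<rfloor>\<close> and finite \<open>1\<close>-variation is the truncated signature of a continuous path of bounded
  variation, by uniqueness of the extension.\<close>

definition geometric_rough_path ::
  "real \<Rightarrow> real \<Rightarrow> (real \<Rightarrow> real \<Rightarrow> 'z::finite tensor) \<Rightarrow> bool" where
  "geometric_rough_path p T X \<longleftrightarrow>
     rough_functional p T (nat \<lfloor>p\<rfloor>) X \<and>
     (\<exists>Y. (\<forall>j::nat. rough_functional 1 T (nat \<lfloor>p\<rfloor>) (Y j)) \<and>
          (\<lambda>j. pvar_dist p T (Y j) X) \<longlonglongrightarrow> 0)"

text \<open>Lyons' extension to degree \<open>n \<ge> \<lfloor>p\<rfloor>\<close>. Only the values on the simplex and on words of length at
  most \<open>n\<close> are meaningful; there the choice is unique by Lyons' extension theorem.\<close>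

definition lyons_extension ::
  "real \<Rightarrow> real \<Rightarrow> nat \<Rightarrow> (real \<Rightarrow> real \<Rightarrow> 'z::finite tensor) \<Rightarrow> real \<Rightarrow> real \<Rightarrow> 'z tensor" where
  "lyons_extension p T n X =
     (SOME Y. rough_functional p T n Y \<and>
        (\<forall>s t w. 0 \<le> s \<and> s \<le> t \<and> t \<le> T \<and> length w \<le> nat \<lfloor>p\<rfloor> \<longrightarrow> Y s t w = X s t w))"

definition trunc_signature ::
  "real \<Rightarrow> real \<Rightarrow> nat \<Rightarrow> (real \<Rightarrow> real \<Rightarrow> 'z::finite tensor) \<Rightarrow> real \<Rightarrow> real \<Rightarrow> 'z tensor" where
  "trunc_signature p T N X s t =
     (\<lambda>w. if length w \<le> N then lyons_extension p T (max N (nat \<lfloor>p\<rfloor>)) X s t w else 0)"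

text \<open>A basis indexed by \<open>'m\<close>; its existence forces \<open>CARD('m)\<close> to be the dimension of the truncated
  tensor space.\<close>

definition trunc_tensor_basis :: "nat \<Rightarrow> ('m::finite \<Rightarrow> 'z tensor) \<Rightarrow> bool" where
  "trunc_tensor_basis N e \<longleftrightarrow>
     (\<forall>i. e i \<in> trunc_tensors N) \<and>
     (\<forall>a\<in>trunc_tensors N. \<exists>!c::real ^ 'm. \<forall>w. a w = (\<Sum>i\<in>UNIV. c $ i * e i w))"

definition coordinate_vector :: "('m::finite \<Rightarrow> 'z tensor) \<Rightarrow> 'z tensor \<Rightarrow> real ^ 'm" where
  "coordinate_vector e a = (THE c. \<forall>w. a w = (\<Sum>i\<in>UNIV. c $ i * e i w))"

definition symmetric_matrix :: "real ^ 'n ^ 'n \<Rightarrow> bool" where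
  "symmetric_matrix S \<longleftrightarrow> transpose S = S"

definition positive_definite :: "real ^ 'n ^ 'n \<Rightarrow> bool" where
  "positive_definite S \<longleftrightarrow> (\<forall>u. u \<noteq> 0 \<longrightarrow> 0 < u \<bullet> (S *v u))"

definition positive_semidefinite :: "real ^ 'n ^ 'n \<Rightarrow> bool" where
  "positive_semidefinite S \<longleftrightarrow> (\<forall>u. 0 \<le> u \<bullet> (S *v u))"

definition outer_product :: "real ^ 'a \<Rightarrow> real ^ 'b \<Rightarrow> real ^ 'b ^ 'a" where
  "outer_product u v = (\<chi> i j. u $ i * v $ j)"

text \<open>The Kronecker product is indexed by pairs in place of flattened indices. In column-major
  vectorisation of an \<open>n \<times> m\<close> matrix \<open>B\<close> the entry \<open>B $ i $ j\<close> has position \<open>(j, i)\<close> (column first), so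
  \<open>vec(B)\<close> is the vector \<open>\<chi> q. B $ snd q $ fst q\<close> of type \<open>real ^ ('m \<times> 'n)\<close>, and every vector of this
  type has that form.\<close>

definition kronecker ::
  "real ^ 'b ^ 'a \<Rightarrow> real ^ 'd ^ 'c \<Rightarrow> real ^ ('b \<times> 'd) ^ ('a \<times> 'c)" where
  "kronecker U V = (\<chi> p q. U $ fst p $ fst q * V $ snd p $ snd q)"

definition kronecker_vec :: "real ^ 'a \<Rightarrow> real ^ 'c \<Rightarrow> real ^ ('a \<times> 'c)" where
  "kronecker_vec u v = (\<chi> p. u $ fst p * v $ snd p)"

definition objective_A ::
  "'a measure \<Rightarrow> real \<Rightarrow> real ^ 'n ^ 'n \<Rightarrow> real ^ 'n ^ 'n \<Rightarrow> real \<Rightarrow> real \<Rightarrow> real \<Rightarrow>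
   (real \<Rightarrow> 'a \<Rightarrow> real ^ 'm) \<Rightarrow> (real \<Rightarrow> 'a \<Rightarrow> real ^ 'm) \<Rightarrow> (real \<Rightarrow> 'a \<Rightarrow> real ^ 'n) \<Rightarrow>
   real ^ ('m \<times> 'n) ^ ('m \<times> 'n)" where
  "objective_A M T \<Lambda> \<Sigma> \<phi> \<eta> \<gamma> x y P =
     - prob_space.expectation M (\<lambda>\<omega>.
         (LINT t:{0..T}|lborel. kronecker (outer_product (x t \<omega>) (x t \<omega>)) \<Lambda>)
       + (LINT t:{0..T}|lborel. kronecker (outer_product (y t \<omega>) (y t \<omega>))
            (\<phi> *\<^sub>R \<Sigma> + \<eta> *\<^sub>R outer_product (P t \<omega>) (P t \<omega>)))
       + \<gamma> *\<^sub>R kronecker (outer_product (y T \<omega>) (y T \<omega>)) (mat 1))"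

definition objective_b ::
  "'a measure \<Rightarrow> real \<Rightarrow> real ^ 'm ^ 'n \<Rightarrow> real ^ 'n \<Rightarrow> real ^ 'n ^ 'n \<Rightarrow> real \<Rightarrow> real \<Rightarrow> real \<Rightarrow>
   (real \<Rightarrow> 'a \<Rightarrow> real ^ 'm) \<Rightarrow> (real \<Rightarrow> 'a \<Rightarrow> real ^ 'm) \<Rightarrow> (real \<Rightarrow> 'a \<Rightarrow> real ^ 'n) \<Rightarrow>
   real ^ ('m \<times> 'n)" where
  "objective_b M T K Q0 \<Sigma> \<phi> \<eta> \<gamma> x y P =
     prob_space.expectation M (\<lambda>\<omega>.
         (LINT t:{0..T}|lborel. kronecker_vec (y t \<omega>)
            (K *v x t \<omega> - (2 * \<phi>) *\<^sub>R (\<Sigma> *v Q0)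
              - (2 * \<eta>) *\<^sub>R (outer_product (P t \<omega>) (P t \<omega>) *v Q0)))
       - (2 * \<gamma>) *\<^sub>R kronecker_vec (y T \<omega>) Q0)"

definition objective_c ::
  "'a measure \<Rightarrow> real \<Rightarrow> real ^ 'm ^ 'n \<Rightarrow> real ^ 'n \<Rightarrow> real ^ 'n ^ 'n \<Rightarrow> real \<Rightarrow> real \<Rightarrow> real \<Rightarrow>
   (real \<Rightarrow> 'a \<Rightarrow> real ^ 'm) \<Rightarrow> (real \<Rightarrow> 'a \<Rightarrow> real ^ 'n) \<Rightarrow> real" where
  "objective_c M T K Q0 \<Sigma> \<phi> \<eta> \<gamma> x P =
     prob_space.expectation M (\<lambda>\<omega>.
         (LINT t:{0..T}|lborel. Q0 \<bullet> (K *v x t \<omega>) - \<phi> * (Q0 \<bullet> (\<Sigma> *v Q0)) - \<eta> * (Q0 \<bullet> P t \<omega>)\<^sup>2)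
       - \<gamma> * (norm Q0)\<^sup>2)"

definition quadratic_objective ::
  "real ^ 'k ^ 'k \<Rightarrow> real ^ 'k \<Rightarrow> real \<Rightarrow> real ^ 'k \<Rightarrow> real" where
  "quadratic_objective A b c \<theta> = \<theta> \<bullet> (A *v \<theta>) + b \<bullet> \<theta> + c"

end

theory Submission
  imports Defs
begin

text \<open>A quadratic function is concave as soon as the negative of its matrix is positive
  semidefinite (\<open>concave_on_quadratic_objective\<close>); the linear and constant parts do not
  matter. Here \<open>-A\<close> is an expectation of time integrals of Kronecker products of a
  rank-one matrix \<open>u u^T\<close> with a positive semidefinite \<open>V\<close>. Writing
  \<theta> = vec(B), the quadratic form of such a product at \<theta> is that of \<open>V\<close> at
  \<open>B u\<close>, hence nonnegative (\<open>inner_kronecker_outer_product\<close>). Positive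
  semidefinite matrices form a convex cone stable under sums, nonnegative multiples and integration
  (\<open>positive_semidefinite_integral\<close>), so positivity for each fixed outcome and time
  passes to \<open>-A\<close>.\<close>

lemma positive_semidefinite_add:
  "positive_semidefinite U \<Longrightarrow> positive_semidefinite V \<Longrightarrow> positive_semidefinite (U + V)"
  by (simp add: positive_semidefinite_def matrix_vector_mult_add_rdistrib inner_add_right)

lemma positive_semidefinite_scaleR:
  "0 \<le> c \<Longrightarrow> positive_semidefinite U \<Longrightarrow> positive_semidefinite (c *\<^sub>R U)"
  by (simp add: positive_semidefinite_def scaleR_matrix_vector_assoc[symmetric])

lemma positive_semidefinite_mat_1: "positive_semidefinite (mat 1)"
  by (simp add: positive_semidefinite_def)

lemma positive_definite_imp_semidefinite:
  assumes "positive_definite U"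
  shows "positive_semidefinite U"
  unfolding positive_semidefinite_def
proof
  fix u
  show "0 \<le> u \<bullet> (U *v u)"
    using assms by (cases "u = 0") (auto simp: positive_definite_def less_imp_le)
qed

text \<open>A rank-one form factors; for equal vectors it is a square, which handles the price term
  \<open>P P^T\<close>.\<close>

lemma inner_outer_product_mult: "u \<bullet> (outer_product p q *v v) = (u \<bullet> p) * (q \<bullet> v)"
proof -
  have "outer_product p q *v v = (q \<bullet> v) *\<^sub>R p"
    by (simp add: outer_product_def inner_vec_def matrix_vector_mult_def vec_eq_iff
        sum_distrib_left mult_ac)
  then show ?thesis by simp
qed

lemma positive_semidefinite_outer_product: "positive_semidefinite (outer_product p p)"
  by (simp add: positive_semidefinite_def inner_outer_product_mult inner_commute)

text \<open>If \<open>\<theta> = vec B\<close>, then the vector \<open>w\<close> below is \<open>B *v u\<close>.\<close>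

lemma inner_kronecker_outer_product:
  fixes u :: "real ^ 'm" and V :: "real ^ 'n ^ 'n" and \<theta> :: "real ^ ('m \<times> 'n)"
  defines "w \<equiv> \<chi> j. \<Sum>i\<in>UNIV. u $ i * \<theta> $ (i, j)"
  shows "\<theta> \<bullet> (kronecker (outer_product u u) V *v \<theta>) = w \<bullet> (V *v w)"
proof -
  let ?f = "\<lambda>i j k l. \<theta> $ (i, j) * u $ i * V $ j $ l * u $ k * \<theta> $ (k, l)"
  have pair_sum: "(\<Sum>p\<in>UNIV. g p) = (\<Sum>i\<in>UNIV. \<Sum>j\<in>UNIV. g (i, j))" for g :: "'m \<times> 'n \<Rightarrow> real"
    by (simp add: sum.cartesian_product)
  have "\<theta> \<bullet> (kronecker (outer_product u u) V *v \<theta>) =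
      (\<Sum>i\<in>UNIV. \<Sum>j\<in>UNIV. \<Sum>k\<in>UNIV. \<Sum>l\<in>UNIV. ?f i j k l)"
    by (simp add: kronecker_def outer_product_def inner_vec_def matrix_vector_mult_def
        pair_sum sum_distrib_left mult_ac)
  \<comment> \<open>The next three swaps move \<open>j\<close> and \<open>l\<close> outside, so that
    the inner sums over \<open>i\<close> and \<open>k\<close> collapse to \<open>w $ j\<close> and
    \<open>w $ l\<close>.\<close>
  also have "\<dots> = (\<Sum>j\<in>UNIV. \<Sum>i\<in>UNIV. \<Sum>l\<in>UNIV. \<Sum>k\<in>UNIV. ?f i j k l)"
    by (subst sum.swap) (intro sum.cong refl sum.swap)
  also have "\<dots> = (\<Sum>j\<in>UNIV. \<Sum>l\<in>UNIV. \<Sum>i\<in>UNIV. \<Sum>k\<in>UNIV. ?f i j k l)"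
    by (intro sum.cong refl sum.swap)
  also have "\<dots> = (\<Sum>j\<in>UNIV. \<Sum>l\<in>UNIV. \<Sum>k\<in>UNIV. \<Sum>i\<in>UNIV. ?f i j k l)"
    by (intro sum.cong refl sum.swap)
  also have "\<dots> = w \<bullet> (V *v w)"
    by (simp add: w_def inner_vec_def matrix_vector_mult_def sum_distrib_left
        sum_distrib_right mult_ac)
  finally show ?thesis .
qed

text \<open>Each of the three summands of \<open>-A\<close> has this shape, with \<open>V\<close>
  equal to \<Lambda>, to \<phi> \<Sigma> + \<eta> \<open>P P^T\<close>, or to the identity.\<close>

lemma positive_semidefinite_kronecker_outer_product:
  "positive_semidefinite V \<Longrightarrow> positive_semidefinite (kronecker (outer_product u u) V)"
  by (simp add: positive_semidefinite_def inner_kronecker_outer_product)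

text \<open>For fixed \<open>u\<close> the map \<open>U\<close> to
  \<open>u \<bullet> (U *v u)\<close> is a bounded linear functional, so it commutes with the
  Bochner integral, and a nonnegative function has a nonnegative integral.\<close>

lemma positive_semidefinite_integral:
  fixes G :: "'a \<Rightarrow> real ^ 'k ^ 'k"
  assumes "\<And>\<omega>. positive_semidefinite (G \<omega>)"
  shows "positive_semidefinite (integral\<^sup>L M G)"
  unfolding positive_semidefinite_def
proof
  fix u :: "real ^ 'k"
  show "0 \<le> u \<bullet> (integral\<^sup>L M G *v u)"
  proof (cases "integrable M G")
    case True
    have "bounded_linear (\<lambda>U :: real ^ 'k ^ 'k. u \<bullet> (U *v u))"
      unfolding linear_conv_bounded_linear[symmetric]
      by (intro linearI)
        (simp_all add: matrix_vector_mult_add_rdistrib inner_add_right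
          scaleR_matrix_vector_assoc[symmetric])
    then have "(\<integral>\<omega>. u \<bullet> (G \<omega> *v u) \<partial>M) = u \<bullet> (integral\<^sup>L M G *v u)"
      using True by (rule integral_bounded_linear)
    moreover have "0 \<le> (\<integral>\<omega>. u \<bullet> (G \<omega> *v u) \<partial>M)"
      using assms by (simp add: positive_semidefinite_def)
    ultimately show ?thesis by simp
  next
    \<comment> \<open>By convention the integral is now the zero matrix, whose form
      vanishes.\<close>
    case False
    then show ?thesis by (simp add: not_integrable_integral_eq)
  qed
qed

lemma positive_semidefinite_set_integral:
  fixes G :: "'a \<Rightarrow> real ^ 'k ^ 'k"
  assumes "\<And>t. positive_semidefinite (G t)"
  shows "positive_semidefinite (LINT t:S|M. G t)"
  unfolding set_lebesgue_integral_def
  by (intro positive_semidefinite_integral positive_semidefinite_scaleR assms indicator_pos_le)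

text \<open>The concavity gap at weights \<open>u\<close>, \<open>v\<close> is exactly
  \<open>- u * v\<close> times the quadratic form of \<open>A\<close> at \<theta> - \<tau>.\<close>

lemma concave_on_quadratic_objective:
  fixes A :: "real ^ 'k ^ 'k"
  assumes "positive_semidefinite (- A)"
  shows "concave_on UNIV (quadratic_objective A b c)"
  unfolding concave_on_iff
proof (intro conjI ballI allI impI convex_UNIV)
  fix \<theta> \<tau> :: "real ^ 'k" and u v :: real
  assume uv: "0 \<le> u" "0 \<le> v" "u + v = 1"
  define q where "q s t = s \<bullet> (A *v t)" for s t
  have neg: "- A *v s = - (A *v s)" for s
    by (simp add: matrix_vector_mult_def vec_eq_iff sum_negf)
  have "q (\<theta> - \<tau>) (\<theta> - \<tau>) \<le> 0"
    using assms by (simp add: positive_semidefinite_def q_def neg)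
  then have "u * v * q (\<theta> - \<tau>) (\<theta> - \<tau>) \<le> 0"
    using uv by (simp add: mult_nonneg_nonpos)
  moreover have "q (u *\<^sub>R \<theta> + v *\<^sub>R \<tau>) (u *\<^sub>R \<theta> + v *\<^sub>R \<tau>) =
      u * q \<theta> \<theta> + v * q \<tau> \<tau> - u * v * q (\<theta> - \<tau>) (\<theta> - \<tau>)"
  proof -
    have expand: "q (u *\<^sub>R \<theta> + v *\<^sub>R \<tau>) (u *\<^sub>R \<theta> + v *\<^sub>R \<tau>) =
        u * u * q \<theta> \<theta> + u * v * q \<theta> \<tau> + u * v * q \<tau> \<theta> + v * v * q \<tau> \<tau>"
      by (simp add: q_def matrix_vector_right_distrib matrix_vector_mult_scaleR inner_add_left
          inner_add_right distrib_left)
    have diff: "q (\<theta> - \<tau>) (\<theta> - \<tau>) = q \<theta> \<theta> - q \<theta> \<tau> - q \<tau> \<theta> + q \<tau> \<tau>"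
      by (simp add: q_def matrix_vector_mult_diff_distrib inner_diff_left inner_diff_right)
    \<comment> \<open>With this, \<open>u * u = u - u * v\<close> and
      \<open>v * v = v - u * v\<close>, so the two expansions match coefficient by
      coefficient.\<close>
    have v: "v = 1 - u"
      using uv by simp
    show ?thesis
      unfolding expand diff unfolding v by (simp add: algebra_simps)
  qed
  \<comment> \<open>The affine part contributes nothing to the gap.\<close>
  moreover have "u * c + v * c = c"
    using uv by (simp flip: distrib_right)
  ultimately show "u * quadratic_objective A b c \<theta> + v * quadratic_objective A b c \<tau>
      \<le> quadratic_objective A b c (u *\<^sub>R \<theta> + v *\<^sub>R \<tau>)"
    by (simp add: quadratic_objective_def q_def inner_add_right distrib_left)
qed

theorem lemma2p10:
  fixes M :: "'a measure" and F :: "real \<Rightarrow> 'a measure" and T p :: real and N :: nat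
    and Z :: "real \<Rightarrow> 'a \<Rightarrow> real ^ 'z"
    and ZZ :: "'a \<Rightarrow> real \<Rightarrow> real \<Rightarrow> 'z tensor"
    and piP :: "real ^ 'z \<Rightarrow> real ^ 'n"
    and e :: "'m::finite \<Rightarrow> 'z tensor"
    and P :: "real \<Rightarrow> 'a \<Rightarrow> real ^ 'n"
    and x y :: "real \<Rightarrow> 'a \<Rightarrow> real ^ 'm"
    and K :: "real ^ 'm ^ 'n" and Q0 :: "real ^ 'n" and \<Lambda> \<Sigma> :: "real ^ 'n ^ 'n"
    and \<phi> \<eta> \<gamma> :: real
  assumes "0 < T" and "prob_space M" and "usual_conditions M T F"
    and "adapted T F Z" and "AE \<omega> in M. continuous_on {0..T} (\<lambda>t. Z t \<omega>)"
    and "linear piP" and "\<And>t \<omega>. P t \<omega> = piP (Z t \<omega>)"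
    and "1 \<le> p" and "AE \<omega> in M. geometric_rough_path p T (ZZ \<omega>)"
    and "AE \<omega> in M. \<forall>s t i. 0 \<le> s \<and> s \<le> t \<and> t \<le> T \<longrightarrow> ZZ \<omega> s t [i] = Z t \<omega> $ i - Z s \<omega> $ i"
    and "\<And>s t w. 0 \<le> s \<Longrightarrow> s \<le> t \<Longrightarrow> t \<le> T \<Longrightarrow> length w \<le> nat \<lfloor>p\<rfloor> \<Longrightarrow>
           (\<lambda>\<omega>. ZZ \<omega> s t w) \<in> borel_measurable (F t)"
    and "trunc_tensor_basis N e"
    and "\<And>t \<omega>. x t \<omega> = coordinate_vector e (trunc_signature p T N (ZZ \<omega>) 0 t)"
    and "\<And>t \<omega>. y t \<omega> = (LINT u:{0..t}|lborel. x u \<omega>)"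
    and "(\<integral>\<^sup>+\<omega>. (\<integral>\<^sup>+t\<in>{0..T}. ennreal ((norm (x t \<omega>))\<^sup>2) \<partial>lborel) \<partial>M) < \<infinity>"
    and "(\<integral>\<^sup>+\<omega>. (\<integral>\<^sup>+t\<in>{0..T}. ennreal ((norm (P t \<omega>))\<^sup>2 * (norm (y t \<omega>))\<^sup>2) \<partial>lborel) \<partial>M) < \<infinity>"
    and "\<And>B :: real ^ 'm ^ 'n. progressively_measurable T F (\<lambda>t \<omega>. B *v x t \<omega>)"
    and "\<And>B :: real ^ 'm ^ 'n.
           (\<integral>\<^sup>+\<omega>. (\<integral>\<^sup>+t\<in>{0..T}. ennreal ((norm (B *v x t \<omega>))\<^sup>2) \<partial>lborel) \<partial>M) < \<infinity>"
    and "symmetric_matrix \<Lambda>" and "positive_definite \<Lambda>"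
    and "symmetric_matrix \<Sigma>" and "positive_semidefinite \<Sigma>"
    and "0 \<le> \<phi>" and "0 \<le> \<eta>" and "0 \<le> \<gamma>"
  shows "concave_on UNIV (quadratic_objective
           (objective_A M T \<Lambda> \<Sigma> \<phi> \<eta> \<gamma> x y P)
           (objective_b M T K Q0 \<Sigma> \<phi> \<eta> \<gamma> x y P)
           (objective_c M T K Q0 \<Sigma> \<phi> \<eta> \<gamma> x P))"
proof (rule concave_on_quadratic_objective)
  show "positive_semidefinite (- objective_A M T \<Lambda> \<Sigma> \<phi> \<eta> \<gamma> x y P)"
    \<comment> \<open>The two signs cancel, leaving an expectation to which the closure rules of the
      cone apply.\<close>
    unfolding objective_A_def minus_minus
    by (intro positive_semidefinite_integral positive_semidefinite_add
        positive_semidefinite_set_integral positive_semidefinite_kronecker_outer_product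
        positive_semidefinite_scaleR positive_semidefinite_outer_product
        positive_semidefinite_mat_1 positive_definite_imp_semidefinite assms)
qed

end
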